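(* Let $n,m$ be positive integers with $1\le n\le 2^{m-1}-1$, and suppose $n=2^{cm}$ with $c\in(0,1)$. Then $$g(n,m)\le \frac{n}{c}\left(6-3.2\log_2 c\right).$$ In particular $g(n,m)=O\!\left(\frac{n}{c}\log_2\frac{1}{c}\right)$.
   Context: Write $[m]=\{1,\ldots,m\}$. For a multiset $\mathcal{F}=\{C_1,\ldots,C_t\}$ of non-empty subsets of $[m]$ (repetitions allowed; members indexed by $[t]$), a resolution into $n$ classes is a partition $\{A_1,\ldots,A_n\}$ of $[t]$ into $n$ blocks such that for each $i$ the sets $C_j$, $j\in A_i$, are pairwise disjoint with union $[m]$. $\mathcal{F}$ is uniquely resolvable with respect to $(n,m)$ if it has exactly one resolution into $n$ classes (partitions regarded as unordered). $g(n,m)$ is the maximum size of a uniquely resolvable multiset with respect to $(n,m)$.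
   Formalization: The O-bound is stated for c at most c0, for each fixed c0 < 1, with a constant depending only on c0; uniformly over all c in (0,1) it fails, since g(n,m) ≥ n while log2(1/c) tends to 0 as c tends to 1 (e.g. n = 2^(m-1) - 1). *)

theory Defs
  imports Complex_Main "HOL-Library.Disjoint_Sets" "HOL-Library.Landau_Symbols"
begin

text \<open>
  A multiset of size \<open>t\<close> is given by an indexing \<open>C 1, \<dots>, C t\<close> of its members; repetitions are
  allowed. Resolutions partition the index set, so interchanging the indices of two equal
  members may produce a different resolution. Reindexing does not affect unique resolvability.
\<close>

definition resolution :: "nat \<Rightarrow> nat \<Rightarrow> nat \<Rightarrow> (nat \<Rightarrow> nat set) \<Rightarrow> nat set set \<Rightarrow> bool" where
  "resolution n m t C P \<longleftrightarrow>
     partition_on {1..t} P \<and> card P = n \<and>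
     (\<forall>A\<in>P. disjoint_family_on C A \<and> (\<Union>j\<in>A. C j) = {1..m})"

definition uniquely_resolvable :: "nat \<Rightarrow> nat \<Rightarrow> nat \<Rightarrow> (nat \<Rightarrow> nat set) \<Rightarrow> bool" where
  "uniquely_resolvable n m t C \<longleftrightarrow>
     (\<forall>j\<in>{1..t}. C j \<noteq> {} \<and> C j \<subseteq> {1..m}) \<and> (\<exists>!P. resolution n m t C P)"

definition g :: "nat \<Rightarrow> nat \<Rightarrow> nat" where
  "g n m = Max {t. \<exists>C. uniquely_resolvable n m t C}"

text \<open>The maximum is attained: the sizes are bounded by \<open>n * m\<close>, and \<open>n\<close> copies of the full set
  are uniquely resolvable.\<close>

lemma uniquely_resolvable_size_le:
  assumes "uniquely_resolvable n m t C"
  shows "t \<le> n * m"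
proof -
  obtain P where P: "resolution n m t C P"
    using assms unfolding uniquely_resolvable_def by blast
  have part: "partition_on {1..t} P" and card: "card P = n"
    using P unfolding resolution_def by auto
  have U: "\<Union>P = {1..t}" using part by (simp add: partition_on_def)
  have "card A \<le> m" if A: "A \<in> P" for A
  proof -
    have sub: "A \<subseteq> {1..t}" using A U by blast
    have disj: "disjoint_family_on C A" and un: "(\<Union>j\<in>A. C j) = {1..m}"
      using P A unfolding resolution_def by auto
    have ne: "C j \<noteq> {}" if "j \<in> A" for j
      using assms sub that unfolding uniquely_resolvable_def by blast
    define f where "f j = (SOME x. x \<in> C j)" for j
    have f: "f j \<in> C j" if "j \<in> A" for j
      unfolding f_def using ne[OF that] by (simp add: some_in_eq)
    have "inj_on f A"
    proof (rule inj_onI, rule ccontr)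
      fix i j assume ij: "i \<in> A" "j \<in> A" "f i = f j" "i \<noteq> j"
      then have "C i \<inter> C j = {}" using disjoint_family_onD[OF disj] by blast
      then show False using f[OF ij(1)] f[OF ij(2)] ij(3) by auto
    qed
    moreover have "f ` A \<subseteq> {1..m}" using f un by blast
    ultimately show ?thesis using card_inj_on_le[of f A "{1..m}"] by simp
  qed
  then have "(\<Sum>A\<in>P. card A) \<le> n * m"
    using sum_bounded_above[of P card m] card by simp
  moreover have "card (\<Union>P) \<le> (\<Sum>A\<in>P. card A)"
    by (rule card_Union_le_sum_card)
  ultimately show ?thesis using U by simp
qed

lemma uniquely_resolvable_copies:
  assumes "m > 0"
  shows "uniquely_resolvable n m n (\<lambda>_. {1..m})"
proof -
  let ?Q = "(\<lambda>j. {j}) ` {1..n}"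
  have Q: "resolution n m n (\<lambda>_. {1..m}) ?Q"
    unfolding resolution_def
    by (auto simp: partition_on_def disjoint_def disjoint_family_on_def card_image)
  have "P = ?Q" if P: "resolution n m n (\<lambda>_. {1..m}) P" for P
  proof -
    have part: "partition_on {1..n} P" using P unfolding resolution_def by auto
    have sing: "\<exists>j. A = {j}" if A: "A \<in> P" for A
    proof -
      obtain j where j: "j \<in> A"
        using A part unfolding partition_on_def by (metis ex_in_conv)
      have disj: "disjoint_family_on (\<lambda>_. {1..m}) A"
        using P A unfolding resolution_def by blast
      have "k = j" if k: "k \<in> A" for k
      proof (rule ccontr)
        assume "k \<noteq> j"
        then have "{1..m} \<inter> {1..m} = {}" by (rule disjoint_family_onD[OF disj k j])
        then show False using assms by simp
      qed
      then show ?thesis using j by blast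
    qed
    have U: "\<Union>P = {1..n}" using part by (simp add: partition_on_def)
    show ?thesis
    proof
      show "P \<subseteq> ?Q" using sing U by blast
      show "?Q \<subseteq> P"
      proof
        fix B assume "B \<in> ?Q"
        then obtain j where "B = {j}" "j \<in> \<Union>P" using U by auto
        then obtain A where A: "A \<in> P" "j \<in> A" by blast
        then obtain k where "A = {k}" using sing by blast
        then show "B \<in> P" using A \<open>B = {j}\<close> by simp
      qed
    qed
  qed
  then show ?thesis
    using Q assms unfolding uniquely_resolvable_def by auto
qed

lemma finite_uniquely_resolvable_sizes: "finite {t. \<exists>C. uniquely_resolvable n m t C}"
  by (rule finite_subset[of _ "{..n * m}"]) (auto dest: uniquely_resolvable_size_le)

lemma g_attained:
  assumes "m > 0"
  shows "\<exists>C. uniquely_resolvable n m (g n m) C"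
  using Max_in[OF finite_uniquely_resolvable_sizes, of n m] uniquely_resolvable_copies[OF assms]
  unfolding g_def by blast

end

theory Submission
  imports Defs "HOL-Combinatorics.Transposition"
begin

text \<open>
  Interchanging two equal members of a uniquely resolvable multiset must leave the resolution
  fixed, which forces the members other than the ground set to be distinct. Hence the \<open>t\<close> members
  contribute \<open>\<Sum>\<^sub>j y ^ card (C j) \<le> (1 + y) ^ m\<close> for small \<open>y > 0\<close>. Their sizes add up to \<open>n m\<close>, so the
  left-hand side is at least \<open>t y\<^bsup>n m / t\<^esup>\<close> by convexity; \<open>y = c / 4\<close> gives the bound on \<open>t\<close>.
\<close>

section \<open>Relabelling equal members\<close>

lemma resolutionD:
  assumes "resolution n m t C P"
  shows "partition_on {1..t} P" "card P = n"
    and "A \<in> P \<Longrightarrow> disjoint_family_on C A" "A \<in> P \<Longrightarrow> (\<Union>j\<in>A. C j) = {1..m}"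
  using assms unfolding resolution_def by auto

lemma resolution_permute:
  assumes "resolution n m t C P" and bij: "bij_betw f {1..t} {1..t}"
    and C: "\<And>j. j \<in> {1..t} \<Longrightarrow> C (f j) = C j"
  shows "resolution n m t C ((`) f ` P)"
proof -
  note part = resolutionD(1)[OF assms(1)] and card = resolutionD(2)[OF assms(1)]
    and cls = resolutionD(3,4)[OF assms(1)]
  have inj: "inj_on f {1..t}" and img: "f ` {1..t} = {1..t}"
    using bij by (auto simp: bij_betw_def)
  have sub: "A \<subseteq> {1..t}" if "A \<in> P" for A
    using that part by (auto simp: partition_on_def)
  have "inj_on ((`) f) P"
    using inj_on_image_eq_iff[OF inj] sub by (auto simp: inj_on_def)
  then have "card ((`) f ` P) = n"
    using card by (simp add: card_image)
  moreover have "partition_on {1..t} ((`) f ` P)"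
  proof -
    \<comment> \<open>\<open>partition_on_inj_image\<close> removes the empty block from the image;
      no block of \<open>P\<close> is empty, so nothing is lost.\<close>
    have "(`) f ` P - {{}} = (`) f ` P"
      using partition_onD3[OF part] by auto
    then show ?thesis
      using partition_on_inj_image[OF part inj] img by simp
  qed
  moreover have "disjoint_family_on C (f ` A) \<and> (\<Union>j\<in>f ` A. C j) = {1..m}" if A: "A \<in> P" for A
  proof
    have eq: "C (f j) = C j" if "j \<in> A" for j
      using C sub[OF A] that by blast
    show "disjoint_family_on C (f ` A)"
      using cls[OF A] eq unfolding disjoint_family_on_def by (metis (no_types, lifting) imageE)
    show "(\<Union>j\<in>f ` A. C j) = {1..m}"
      using cls[OF A] eq by auto
  qed
  ultimately show ?thesis
    unfolding resolution_def by blast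
qed

text \<open>Suppose \<open>C i = C j\<close> with \<open>i \<noteq> j\<close>. Swapping
  \<open>i\<close> and \<open>j\<close> preserves the resolution. The class of \<open>i\<close> has
  a further index \<open>k\<close>, because \<open>C i\<close> alone does not cover the ground set.
  The swap keeps \<open>k\<close> in place, so it fixes that class and puts \<open>j\<close> into
  it, against disjointness.\<close>

lemma uniquely_resolvable_inj_on:
  assumes "uniquely_resolvable n m t C"
  shows "inj_on C {j \<in> {1..t}. C j \<noteq> {1..m}}"
proof (rule inj_onI, rule ccontr)
  fix i j
  assume "i \<in> {j \<in> {1..t}. C j \<noteq> {1..m}}" "j \<in> {j \<in> {1..t}. C j \<noteq> {1..m}}"
    and eq: "C i = C j" and ne: "i \<noteq> j"
  then have i: "i \<in> {1..t}" "C i \<noteq> {1..m}" and j: "j \<in> {1..t}" by auto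
  have ex1: "\<exists>!P. resolution n m t C P"
    using assms by (simp add: uniquely_resolvable_def)
  then obtain P where P: "resolution n m t C P" by (rule ex1E)
  note part = resolutionD(1)[OF P] and cls = resolutionD(3,4)[OF P]
  let ?f = "transpose i j"
  have "resolution n m t C ((`) ?f ` P)"
  proof (rule resolution_permute[OF P])
    show "bij_betw ?f {1..t} {1..t}"
      using i(1) j by simp
    show "C (?f k) = C k" for k
      using eq by (simp add: transpose_def)
  qed
  then have fixed: "(`) ?f ` P = P"
    using ex1 P by blast
  obtain A where A: "A \<in> P" "i \<in> A"
    using i(1) partition_onD1[OF part] by blast
  have "j \<notin> A"
  proof
    assume "j \<in> A"
    then have "C i \<inter> C j = {}"
      using cls[OF A(1)] A(2) ne by (auto dest: disjoint_family_onD)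
    then show False
      using eq assms i unfolding uniquely_resolvable_def by auto
  qed
  have "A \<noteq> {i}"
    using cls[OF A(1)] i(2) by auto
  then obtain k where k: "k \<in> A" "k \<noteq> i" using A(2) by blast
  have "?f k \<in> ?f ` A" "?f i \<in> ?f ` A" using k A by blast+
  moreover have "?f k = k" "?f i = j" using k \<open>j \<notin> A\<close> by (auto simp: transpose_def)
  moreover have "?f ` A \<in> P" using A(1) fixed by blast
  ultimately have "k \<in> ?f ` A" "j \<in> ?f ` A" "?f ` A \<in> P" by simp_all
  moreover from this have "?f ` A = A"
    using disjointD[OF partition_onD2[OF part] _ A(1), of "?f ` A"] k(1) by blast
  ultimately show False using \<open>j \<notin> A\<close> by simp
qed

section \<open>Weights of the members\<close>

lemma resolution_sum_card:
  assumes P: "resolution n m t C P"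
  shows "(\<Sum>j\<in>{1..t}. card (C j)) = n * m"
proof -
  note part = resolutionD(1)[OF P] and card = resolutionD(2)[OF P] and cls = resolutionD(3,4)[OF P]
  have U: "\<Union>P = {1..t}" using part by (simp add: partition_on_def)
  have fin: "finite A" if "A \<in> P" for A
    using that U by (metis Sup_upper finite_atLeastAtMost finite_subset)
  have "(\<Sum>j\<in>A. card (C j)) = m" if A: "A \<in> P" for A
  proof -
    have "finite (C j)" if "j \<in> A" for j
      using cls[OF A] that by (metis UN_upper finite_atLeastAtMost finite_subset)
    then have "card (\<Union>j\<in>A. C j) = (\<Sum>j\<in>A. card (C j))"
      using cls[OF A] fin[OF A] by (intro card_UN_disjoint) (auto simp: disjoint_family_on_def)
    then show ?thesis using cls[OF A] by simp
  qed
  moreover have "(\<Sum>j\<in>\<Union>P. card (C j)) = (\<Sum>A\<in>P. \<Sum>j\<in>A. card (C j))"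
    using part fin by (subst sum.Union_disjoint) (auto simp: partition_on_def disjoint_def)
  ultimately show ?thesis using U card by simp
qed

lemma sum_power_card_Pow:
  fixes y :: "'a :: comm_semiring_1"
  assumes "finite A"
  shows "(\<Sum>X\<in>Pow A. y ^ card X) = (1 + y) ^ card A"
proof -
  have "(1 + y) ^ card A = (\<Prod>a\<in>A. y + 1)"
    by (simp add: add.commute)
  also have "\<dots> = (\<Sum>X\<in>Pow A. (\<Prod>a\<in>X. y) * (\<Prod>a\<in>A - X. 1))"
    by (rule prod_add[OF assms])
  finally show ?thesis by simp
qed

text \<open>Jensen's inequality for the convex function \<open>y powr x\<close>, proved with its
  tangent at the mean.\<close>

lemma sum_powr_ge_card_mult_powr_mean:
  fixes a :: "'a \<Rightarrow> real"
  assumes "finite J" "J \<noteq> {}" "y > 0"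
  shows "real (card J) * y powr ((\<Sum>j\<in>J. a j) / card J) \<le> (\<Sum>j\<in>J. y powr a j)"
proof -
  define \<mu> where "\<mu> = (\<Sum>j\<in>J. a j) / card J"
  have tangent: "y powr \<mu> * (1 + (a j - \<mu>) * ln y) \<le> y powr a j" for j
  proof -
    have "1 + (a j - \<mu>) * ln y \<le> y powr (a j - \<mu>)"
      unfolding powr_def using exp_ge_add_one_self[of "(a j - \<mu>) * ln y"] assms(3) by simp
    then have "y powr \<mu> * (1 + (a j - \<mu>) * ln y) \<le> y powr \<mu> * y powr (a j - \<mu>)"
      by (rule mult_left_mono) simp
    also have "\<dots> = y powr a j" by (simp flip: powr_add)
    finally show ?thesis .
  qed
  \<comment> \<open>Deviations from the mean cancel, so only the constant terms of the tangents
    survive.\<close>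
  have "(\<Sum>j\<in>J. a j - \<mu>) = 0"
    using assms by (simp add: sum_subtractf \<mu>_def)
  then have "(\<Sum>j\<in>J. 1 + (a j - \<mu>) * ln y) = real (card J)"
    by (simp only: sum.distrib sum_distrib_right[symmetric]) simp
  then have "real (card J) * y powr \<mu> = (\<Sum>j\<in>J. y powr \<mu> * (1 + (a j - \<mu>) * ln y))"
    by (simp only: sum_distrib_left[symmetric] mult.commute)
  also have "\<dots> \<le> (\<Sum>j\<in>J. y powr a j)"
    by (intro sum_mono tangent)
  finally show ?thesis by (simp only: \<mu>_def)
qed

text \<open>Proper members are distinct non-empty sets, so they weigh at most
  \<open>(1 + y) ^ m - 1\<close>. The copies of the ground set number at most \<open>n\<close> and
  weigh at most \<open>n * y ^ m \<le> 1\<close>, which fills the gap left by the empty set.\<close>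

lemma uniquely_resolvable_sum_power_le:
  fixes y :: real
  assumes F: "uniquely_resolvable n m t C" and y: "0 < y" and small: "real n * y ^ m \<le> 1"
  shows "(\<Sum>j\<in>{1..t}. y ^ card (C j)) \<le> (1 + y) ^ m"
proof -
  obtain P where P: "resolution n m t C P"
    using F unfolding uniquely_resolvable_def by blast
  have ne: "C j \<noteq> {}" and sub: "C j \<subseteq> {1..m}" if "j \<in> {1..t}" for j
    using F that unfolding uniquely_resolvable_def by auto
  define G where "G = {j \<in> {1..t}. C j = {1..m}}"
  define H where "H = {j \<in> {1..t}. C j \<noteq> {1..m}}"
  have split: "(\<Sum>j\<in>{1..t}. y ^ card (C j)) = (\<Sum>j\<in>G. y ^ card (C j)) + (\<Sum>j\<in>H. y ^ card (C j))"
    unfolding G_def H_def by (subst sum.union_disjoint[symmetric]) (auto intro: sum.cong)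
  have full: "(\<Sum>j\<in>G. y ^ card (C j)) \<le> 1"
  \<comment> \<open>The count of copies cancels a factor \<open>m\<close>; for \<open>m = 0\<close>
    the ground set is empty and cannot be a member.\<close>
  proof (cases "m = 0")
    case True
    then have "G = {}" using ne by (auto simp: G_def)
    then show ?thesis by simp
  next
    case False
    have "card G * m = (\<Sum>j\<in>G. card (C j))" by (simp add: G_def)
    also have "\<dots> \<le> (\<Sum>j\<in>{1..t}. card (C j))" by (rule sum_mono2) (auto simp: G_def)
    also have "\<dots> = n * m" by (rule resolution_sum_card[OF P])
    finally have "card G \<le> n" using False by simp
    then have "real (card G) * y ^ m \<le> real n * y ^ m"
      using y by (intro mult_right_mono) auto
    then show ?thesis using small by (simp add: G_def)
  qed
  have "(\<Sum>j\<in>H. y ^ card (C j)) = (\<Sum>X\<in>C ` H. y ^ card X)"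
    using uniquely_resolvable_inj_on[OF F] by (simp add: H_def sum.reindex)
  also have "\<dots> \<le> (\<Sum>X\<in>Pow {1..m} - {{}}. y ^ card X)"
    using ne sub y by (intro sum_mono2) (auto simp: H_def)
  also have "\<dots> = (1 + y) ^ m - 1"
    by (subst sum_diff) (simp_all add: sum_power_card_Pow)
  finally show ?thesis using split full by linarith
qed

section \<open>The bound on the size\<close>

lemma uniquely_resolvable_size_bound:
  fixes c :: real
  assumes F: "uniquely_resolvable n m t C"
    and m: "1 \<le> m" and n: "1 \<le> n" "n \<le> 4 ^ m" and c: "0 < c" "c < 1"
    and nc: "real n = 2 powr (c * real m)"
  shows "real t \<le> real n / c * (4 - 2 * log 2 c)"
\<comment> \<open>If \<open>t \<le> n\<close>, the claim holds since both \<open>1 / c\<close> and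
  \<open>4 - 2 * log 2 c\<close> are at least 1.\<close>
proof (cases "t \<le> n")
  case True
  have "log 2 c < 0" using c by simp
  then have "1 \<le> 4 - 2 * log 2 c" by linarith
  then have "1 * 1 \<le> 1 / c * (4 - 2 * log 2 c)"
    using c by (intro mult_mono) simp_all
  then have "real n * 1 \<le> real n * (1 / c * (4 - 2 * log 2 c))"
    by (intro mult_left_mono) auto
  then show ?thesis using True by simp
next
  case False
  then have t: "0 < t" "n \<le> t" by auto
  obtain P where P: "resolution n m t C P"
    using F unfolding uniquely_resolvable_def by blast
  \<comment> \<open>With this choice \<open>log 2 (1 + y) \<le> 2 * y = c / 2\<close> uses up only
    half of the \<open>c * m\<close> supplied by \<open>log 2 n\<close>. Also
    \<open>y \<le> 1 / 4\<close> gives \<open>n * y ^ m \<le> 1\<close>.\<close>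
  define y where "y = c / 4"
  have y: "0 < y" "y \<le> 1 / 4" using c by (auto simp: y_def)
  have "y ^ m \<le> (1 / 4) ^ m" using y by (intro power_mono) auto
  moreover have "real n \<le> 4 ^ m" using n(2) by (metis of_nat_le_iff of_nat_numeral of_nat_power)
  ultimately have "real n * y ^ m \<le> 4 ^ m * (1 / 4) ^ m"
    using y by (intro mult_mono) auto
  then have small: "real n * y ^ m \<le> 1" by (simp add: power_divide)
  define \<mu> where "\<mu> = real n * real m / real t"
  have \<mu>: "(\<Sum>j\<in>{1..t}. real (card (C j))) / card {1..t} = \<mu>"
    using resolution_sum_card[OF P] by (simp add: \<mu>_def flip: of_nat_sum of_nat_mult)
  \<comment> \<open>Weakening \<open>t\<close> to \<open>n\<close> makes the logarithm of the first
    factor exactly \<open>c * m\<close>; \<open>t\<close> remains only in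
    \<open>\<mu>\<close>.\<close>
  have "real n * y powr \<mu> \<le> real t * y powr \<mu>"
    using t by (intro mult_right_mono) auto
  also have "\<dots> \<le> (\<Sum>j\<in>{1..t}. y powr card (C j))"
    using sum_powr_ge_card_mult_powr_mean[of "{1..t}" y "\<lambda>j. card (C j)"] t y \<mu> by simp
  also have "\<dots> \<le> (1 + y) ^ m"
    using uniquely_resolvable_sum_power_le[OF F y(1) small] y by (simp add: powr_realpow)
  finally have "ln (real n * y powr \<mu>) \<le> ln ((1 + y) ^ m)"
    using n y by (subst ln_le_cancel_iff) auto
  then have "log 2 (real n * y powr \<mu>) \<le> log 2 ((1 + y) ^ m)"
    by (simp add: log_def divide_right_mono)
  then have "c * m + \<mu> * log 2 y \<le> m * log 2 (1 + y)"
    using n y nc by (simp add: log_mult log_powr log_nat_power)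
  moreover have "log 2 (1 + y) \<le> 2 * y"
  proof -
    have "ln (1 + y) \<le> y" using y by (intro ln_add_one_self_le_self) auto
    \<comment> \<open>This is \<open>ln 2 \<ge> 1 / 2\<close>, obtained from
      \<open>ln x \<le> x - 1\<close> at \<open>x = 1 / 2\<close>.\<close>
    also have "y \<le> 2 * y * ln 2"
      using y ln_le_minus_one[of "1 / 2"] by (simp add: ln_div)
    finally show ?thesis by (simp add: log_def divide_le_eq)
  qed
  then have "m * log 2 (1 + y) \<le> m * (c / 2)"
    by (intro mult_left_mono) (auto simp: y_def)
  moreover have "log 2 y = log 2 c - 2"
    using c log_pow_cancel[of 2 2] by (simp add: y_def log_divide)
  ultimately have "m * (c / 2) \<le> \<mu> * (2 - log 2 c)"
    by (simp add: algebra_simps)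
  then have "real m * (c / 2) \<le> real m * (real n * (2 - log 2 c) / real t)"
    by (simp add: \<mu>_def mult_ac)
  then have "c / 2 \<le> real n * (2 - log 2 c) / real t"
    using m by (subst (asm) mult_le_cancel_left_pos) auto
  then show ?thesis
    using t c by (simp add: field_simps)
qed

theorem theorem27:
  "(\<forall>(n::nat) (m::nat) (c::real).
      1 \<le> n \<and> 1 \<le> m \<and> n \<le> 2 ^ (m - 1) - 1 \<and> 0 < c \<and> c < 1 \<and> real n = 2 powr (c * real m) \<longrightarrow>
      real (g n m) \<le> real n / c * (6 - 3.2 * log 2 c)) \<and>
   (\<forall>c0::real. c0 < 1 \<longrightarrow>
      (\<lambda>(n, m, c). real (g n m))
        \<in> O[principal {(n::nat, m::nat, c::real). 1 \<le> n \<and> 1 \<le> m \<and> n \<le> 2 ^ (m - 1) - 1 \<and>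
                          0 < c \<and> c \<le> c0 \<and> real n = 2 powr (c * real m)}](
           \<lambda>(n, m, c). real n / c * log 2 (1 / c)))"
proof -
  \<comment> \<open>Sharper than the first claim, as \<open>log 2 c < 0\<close>; the asymptotic
    claim follows from it too.\<close>
  have bound: "real (g n m) \<le> real n / c * (4 - 2 * log 2 c)"
    if hyps: "1 \<le> n" "1 \<le> m" "n \<le> 2 ^ (m - 1) - 1" "0 < c" "c < 1" "real n = 2 powr (c * real m)"
    for n m :: nat and c :: real
  proof -
    obtain C where C: "uniquely_resolvable n m (g n m) C"
      using g_attained[of m n] hyps(2) by auto
    have "(2::nat) ^ (m - 1) \<le> 4 ^ (m - 1)" by (rule power_mono) auto
    also have "\<dots> \<le> 4 ^ m" by (rule power_increasing) auto
    finally have "n \<le> 4 ^ m" using hyps(3) by simp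
    then show ?thesis
      using uniquely_resolvable_size_bound[OF C] hyps by blast
  qed
  show ?thesis
  proof (intro conjI allI impI, goal_cases)
    case (1 n m c)
    then have "log 2 c < 0" by simp
    then have "4 - 2 * log 2 c \<le> 6 - 3.2 * log 2 c" by linarith
    then have "real n / c * (4 - 2 * log 2 c) \<le> real n / c * (6 - 3.2 * log 2 c)"
      using 1 by (intro mult_left_mono) simp_all
    then show ?case using bound[of n m c] 1 by linarith
  next
    case (2 c0)
    show ?case
    \<comment> \<open>Since \<open>c \<le> c0 < 1\<close>, \<open>log 2 (1 / c)\<close> is at least
      \<open>d = log 2 (1 / c0) > 0\<close>, so the constant 4 is absorbed as
      \<open>4 \<le> (4 / d) * log 2 (1 / c)\<close>. For \<open>c0 \<le> 0\<close> the set is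
      empty.\<close>
    proof (rule bigoI[where c = "4 / log 2 (1 / c0) + 2"], unfold eventually_principal, clarify, goal_cases)
      case (1 n m c)
      define d where "d = log 2 (1 / c0)"
      have d: "0 < d" using 1 2 by (simp add: d_def log_divide)
      have dc: "d \<le> log 2 (1 / c)" using 1 by (simp add: d_def log_divide)
      have "real (g n m) \<le> real n / c * (4 + 2 * log 2 (1 / c))"
        using bound[of n m c] 1 2 by (simp add: log_divide)
      also have "\<dots> \<le> real n / c * ((4 / d + 2) * log 2 (1 / c))"
        using 1 2 d dc by (intro mult_left_mono) (auto simp: field_simps)
      finally have "real (g n m) \<le> (4 / d + 2) * (real n / c * log 2 (1 / c))"
        by (simp add: mult_ac)
      moreover have "0 \<le> real n / c * log 2 (1 / c)"
        using 1 2 d dc by (intro mult_nonneg_nonneg) auto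
      ultimately show ?case
        unfolding d_def prod.case real_norm_def by (simp only: abs_of_nonneg of_nat_0_le_iff)
    qed
  qed
qed

end
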